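(* Let $\mathcal{S}=\{(i,j)\in\mathbb{Z}\times\mathbb{Z}\mid i\ge 2j\}$ and $\mathcal{S}'=\{(i,j)\in\mathbb{Z}\times\mathbb{Z}\mid i<2j\}$, and let $f:\mathcal{S}\times\mathcal{S}'\to\mathbb{F}_2$ be the function with $f((i,j),(l,m))=\binom{m-j-1}{m+j-l-1}$ modulo $2$ if $i+j=l+m$ and $f((i,j),(l,m))=0$ otherwise. The (dualizable, $(\mathbb{Z},\mathcal{S})$-admissible) quadratic coalgebra $\langle\mathbb{Z};\mathcal{S},f\rangle$ over $\mathbb{F}_2$ is strictly self-dual with respect to the bijection $\sigma:\mathbb{Z}\to\mathbb{Z}$, $n\mapsto 1-n$.
   Context: Convention: $\binom{a}{b}=0$ if $a<0$ or $b<0$ (or $b>a$). For a field $\mathbb{K}$, a $\mathbb{K}$-vector space $V$ and a subspace $R\le V^{\otimes2}$, let $\langle V;R\rangle$ be the graded subcoalgebra of the tensor coalgebra $T_c(V)$ (deconcatenation coproduct) given by $\mathbb{K}$ in degree $0$, $V$ in degree $1$ and $\bigcap_{i+j+2=n}V^{\otimes i}\otimes R\otimes V^{\otimes j}$ in degree $n\ge2$. Write $\mathbb{K}[\mathcal{I}]$ for the free $\mathbb{K}$-vector space on a set $\mathcal{I}$, with basis elements $[i]$, and identify $\mathbb{K}[\mathcal{I}]\otimes\mathbb{K}[\mathcal{I}]=\mathbb{K}[\mathcal{I}\times\mathcal{I}]$. Given a set $\mathcal{I}$, a subset $\mathcal{S}\subset\mathcal{I}\times\mathcal{I}$ with complement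 $\mathcal{S}'$, and a function $f:\mathcal{S}\times\mathcal{S}'\to\mathbb{K}$ such that $f(s,-)$ has finite support for each $s\in\mathcal{S}$, $\langle\mathcal{I};\mathcal{S},f\rangle$ denotes the $(\mathcal I,\mathcal S)$-admissible quadratic coalgebra $\langle\mathbb{K}[\mathcal{I}];R\rangle$, where $R$ is the span of the elements $[s]-\sum_{s'\in\mathcal{S}'}f(s,s')[s']$, $s\in\mathcal{S}$. It is dualizable if $f(-,s')$ has finite support for each $s'\in\mathcal{S}'$. Define $f^!:\mathcal{S}'\times\mathcal{S}\to\mathbb{K}$ by $f^!(s',s)=f(s,s')$. A dualizable $\langle\mathcal{I};\mathcal{S},f\rangle$ is strictly self-dual with respect to a bijection $\sigma:\mathcal{I}\to\mathcal{I}$ if (1) $\sigma\times\sigma$ restricts to a bijection $\mathcal{S}\to\mathcal{S}'$, and (2) $f=f^!\circ(\sigma\times\sigma)$, i.e. $f(s,s')=f^!(\sigma(s),\sigma(s'))=f(\sigma(s'),\sigma(s))$ for all $s\in\mathcal{S}$, $s'\in\mathcal{S}'$, where $\sigma$ is applied componentwise to pairs. (The coalgebra $\langle\mathbb{Z};\mathcal{S},f\rangle$ of the claim is isomorphic to the underlying coalgebra of the graded bialgebra $\mathcal{B}$ with $\mathcal{B}_n=\mathbb{F}_2[\alpha_1,\ldots,\alpha_{n-1},\alpha_n^{\pm1}]$ and coproduct $\alpha_k\mapsto\sum_{s+t=k}\alpha_s^{2^t}\otimes\alpha_t$.) *)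

theory Defs
  imports Complex_Main "HOL-Library.Poly_Mapping" "HOL-Library.Z2"
begin

text \<open>
  The free vector space K[X] on X is the type of finitely supported functions \<open>'x \<Rightarrow>\<^sub>0 'k\<close>,
  with basis elements \<open>Poly_Mapping.single x 1\<close>; the set X is the whole type \<open>'x\<close>.
\<close>

definition fscale :: "'k::field \<Rightarrow> ('x \<Rightarrow>\<^sub>0 'k) \<Rightarrow> ('x \<Rightarrow>\<^sub>0 'k)" where
  "fscale c p = Poly_Mapping.map ((*) c) p"

lemma lookup_fscale [simp]: "Poly_Mapping.lookup (fscale c p) x = c * Poly_Mapping.lookup p x"
  by (simp add: fscale_def Poly_Mapping.map.rep_eq when_def)

interpretation free_vs: vector_space fscale
  by standard
    (auto intro!: poly_mapping_eqI simp: Poly_Mapping.lookup_add algebra_simps)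

definition lin_ext :: "('x \<Rightarrow> ('y \<Rightarrow>\<^sub>0 'k::field)) \<Rightarrow> ('x \<Rightarrow>\<^sub>0 'k) \<Rightarrow> ('y \<Rightarrow>\<^sub>0 'k)" where
  "lin_ext g p = (\<Sum>x\<in>Poly_Mapping.keys p. fscale (Poly_Mapping.lookup p x) (g x))"

text \<open>
  For V = K[I], the n-th tensor power of V is K[I^n], so the tensor coalgebra T(V) is the
  free vector space on lists over I and its tensor square is the free vector space on pairs
  of lists.
\<close>

record (overloaded) ('i, 'k) graded_coalgebra =
  component :: "nat \<Rightarrow> ('i list \<Rightarrow>\<^sub>0 'k) set"
  coproduct :: "('i list \<Rightarrow>\<^sub>0 'k) \<Rightarrow> ('i list \<times> 'i list \<Rightarrow>\<^sub>0 'k)"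
  counit :: "('i list \<Rightarrow>\<^sub>0 'k) \<Rightarrow> 'k"

definition deconcatenation :: "('i list \<Rightarrow>\<^sub>0 'k::field) \<Rightarrow> ('i list \<times> 'i list \<Rightarrow>\<^sub>0 'k)" where
  "deconcatenation =
     lin_ext (\<lambda>w. \<Sum>k\<le>length w. Poly_Mapping.single (take k w, drop k w) 1)"

definition tensor_power :: "nat \<Rightarrow> ('i list \<Rightarrow>\<^sub>0 'k::field) set" where
  "tensor_power n = free_vs.span ((\<lambda>w. Poly_Mapping.single w 1) ` {w. length w = n})"

text \<open>The tensor product of \<open>V^i\<close>, \<open>R\<close> and \<open>V^j\<close>, as a subspace of \<open>V^(i+2+j)\<close>.\<close>

definition relations_at ::
    "('i \<times> 'i \<Rightarrow>\<^sub>0 'k::field) set \<Rightarrow> nat \<Rightarrow> nat \<Rightarrow> ('i list \<Rightarrow>\<^sub>0 'k) set" where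
  "relations_at R i j = free_vs.span
     {lin_ext (\<lambda>(a, b). Poly_Mapping.single (u @ [a, b] @ v) 1) r | u r v.
        length u = i \<and> r \<in> R \<and> length v = j}"

definition quadratic_component ::
    "('i \<times> 'i \<Rightarrow>\<^sub>0 'k::field) set \<Rightarrow> nat \<Rightarrow> ('i list \<Rightarrow>\<^sub>0 'k) set" where
  "quadratic_component R n =
     (if n < 2 then tensor_power n
      else (\<Inter>(i, j) \<in> {(i, j). i + j + 2 = n}. relations_at R i j))"

text \<open>
  The structure maps are those of the whole tensor coalgebra; the subcoalgebra is determined
  by its homogeneous components.
\<close>

definition quadratic_coalgebra ::
    "('i \<times> 'i \<Rightarrow>\<^sub>0 'k::field) set \<Rightarrow> ('i, 'k) graded_coalgebra" where
  "quadratic_coalgebra R =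
     \<lparr>component = quadratic_component R,
      coproduct = deconcatenation,
      counit = (\<lambda>p. Poly_Mapping.lookup p [])\<rparr>"

text \<open>
  A function on \<open>S \<times> - S\<close> is represented by a total function of which only the values on
  \<open>S \<times> - S\<close> are used.
\<close>

definition admissible_relations ::
    "('i \<times> 'i) set \<Rightarrow> ('i \<times> 'i \<Rightarrow> 'i \<times> 'i \<Rightarrow> 'k::field) \<Rightarrow> ('i \<times> 'i \<Rightarrow>\<^sub>0 'k) set" where
  "admissible_relations S f = free_vs.span
     ((\<lambda>s. Poly_Mapping.single s 1
           - (\<Sum>s' \<in> {s' \<in> - S. f s s' \<noteq> 0}. Poly_Mapping.single s' (f s s'))) ` S)"

definition admissible_coalgebra ::
    "('i \<times> 'i) set \<Rightarrow> ('i \<times> 'i \<Rightarrow> 'i \<times> 'i \<Rightarrow> 'k::field) \<Rightarrow> ('i, 'k) graded_coalgebra" where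
  "admissible_coalgebra S f = quadratic_coalgebra (admissible_relations S f)"

text \<open>
  The properties below belong to a coalgebra together with its presentation \<open>(S, f)\<close>.
  Finiteness of the supports is what makes the sums in \<open>admissible_relations\<close> meaningful.
\<close>

definition admissible_presentation ::
    "('i, 'k) graded_coalgebra \<Rightarrow> ('i \<times> 'i) set \<Rightarrow> ('i \<times> 'i \<Rightarrow> 'i \<times> 'i \<Rightarrow> 'k::field) \<Rightarrow> bool" where
  "admissible_presentation C S f \<longleftrightarrow>
     (\<forall>s\<in>S. finite {s' \<in> - S. f s s' \<noteq> 0}) \<and> C = admissible_coalgebra S f"

definition dualizable ::
    "('i, 'k) graded_coalgebra \<Rightarrow> ('i \<times> 'i) set \<Rightarrow> ('i \<times> 'i \<Rightarrow> 'i \<times> 'i \<Rightarrow> 'k::field) \<Rightarrow> bool" where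
  "dualizable C S f \<longleftrightarrow>
     admissible_presentation C S f \<and> (\<forall>s' \<in> - S. finite {s \<in> S. f s s' \<noteq> 0})"

definition dual_function ::
    "('i \<times> 'i \<Rightarrow> 'i \<times> 'i \<Rightarrow> 'k) \<Rightarrow> ('i \<times> 'i \<Rightarrow> 'i \<times> 'i \<Rightarrow> 'k)" where
  "dual_function f s' s = f s s'"

definition strictly_self_dual ::
    "('i, 'k) graded_coalgebra \<Rightarrow> ('i \<times> 'i) set \<Rightarrow> ('i \<times> 'i \<Rightarrow> 'i \<times> 'i \<Rightarrow> 'k::field)
      \<Rightarrow> ('i \<Rightarrow> 'i) \<Rightarrow> bool" where
  "strictly_self_dual C S f \<sigma> \<longleftrightarrow>
     dualizable C S f \<and> bij \<sigma> \<and>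
     bij_betw (map_prod \<sigma> \<sigma>) S (- S) \<and>
     (\<forall>s\<in>S. \<forall>s' \<in> - S.
        f s s' = dual_function f (map_prod \<sigma> \<sigma> s) (map_prod \<sigma> \<sigma> s'))"

text \<open>Binomial coefficients of integers, vanishing unless \<open>0 \<le> b \<le> a\<close>.\<close>

definition int_binomial :: "int \<Rightarrow> int \<Rightarrow> nat" where
  "int_binomial a b = (if a < 0 \<or> b < 0 then 0 else nat a choose nat b)"

end

theory Submission
  imports Defs
begin

text \<open>Self-duality is the symmetry C(a,b) = C(a,a-b). Replacing (s,s') = ((i,j),(l,m)) by
  (sigma s', sigma s) keeps the condition i+j = l+m and the upper index a = m-j-1, and turns the
  lower index b = m+j-l-1 into i-j-m, which equals a-b when i+j = l+m. The two finiteness conditions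
  hold because a nonzero coefficient forces 0 <= b <= a, which bounds the free index once the degree
  is fixed.\<close>

lemma int_binomial_symmetric:
  assumes "0 \<le> a"
  shows "int_binomial a (a - b) = int_binomial a b"
proof (cases "0 \<le> b \<and> b \<le> a")
  case True
  then have "nat (a - b) = nat a - nat b" "nat b \<le> nat a" by auto
  then show ?thesis
    using True binomial_symmetric[of "nat b" "nat a"] by (simp add: int_binomial_def)
next
  \<comment> \<open>Reflection b -> a-b preserves the interval [0,a], so outside it both sides
    vanish by convention.\<close>
  case False
  then show ?thesis
    by (auto simp: int_binomial_def)
qed

lemma int_binomial_eq_0_iff: "int_binomial a b = 0 \<longleftrightarrow> \<not> (0 \<le> b \<and> b \<le> a)"
  by (auto simp: int_binomial_def not_less)

theorem theorem5p3p1: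
  fixes S S' :: "(int \<times> int) set"
    and f :: "int \<times> int \<Rightarrow> int \<times> int \<Rightarrow> bit"
  assumes S: "S = {(i, j). i \<ge> 2 * j}"
    and S': "S' = {(i, j). i < 2 * j}"
    and f: "\<And>i j l m. (i, j) \<in> S \<Longrightarrow> (l, m) \<in> S' \<Longrightarrow>
      f (i, j) (l, m) =
        (if i + j = l + m then of_nat (int_binomial (m - j - 1) (m + j - l - 1)) else 0)"
  shows "S' = - S \<and> strictly_self_dual (admissible_coalgebra S f) S f (\<lambda>n. 1 - n)"
proof -
  let ?\<sigma> = "\<lambda>n :: int. 1 - n"
  have compl: "- S = S'"
    using S S' by auto
  \<comment> \<open>Here 0 <= b reads l < m+j, and b <= a reads 2j <= l.\<close>
  have nz: "i + j = l + m \<and> 2 * j \<le> l \<and> l < m + j"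
    if "(i, j) \<in> S" "(l, m) \<in> S'" "f (i, j) (l, m) \<noteq> 0" for i j l m
  proof -
    have "i + j = l + m" "int_binomial (m - j - 1) (m + j - l - 1) \<noteq> 0"
      using that f[of i j l m] by (auto split: if_splits intro: gr0I)
    then show ?thesis
      by (auto simp: int_binomial_eq_0_iff)
  qed
  have fin: "finite {s' \<in> - S. f s s' \<noteq> 0}" if "s \<in> S" for s
  proof -
    obtain i j where s: "s = (i, j)" by fastforce
    \<comment> \<open>From 2j <= l < m+j follows j < m, and 2j <= l = i+j-m gives m <= i-j.\<close>
    have "{s' \<in> - S. f s s' \<noteq> 0} \<subseteq> (\<lambda>m. (i + j - m, m)) ` {j..i - j}"
    proof clarify
      fix l m assume "(l, m) \<notin> S" "f s (l, m) \<noteq> 0"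
      then have "i + j = l + m \<and> 2 * j \<le> l \<and> l < m + j"
        using nz that s compl by blast
      then have "l = i + j - m" "m \<in> {j..i - j}" by auto
      then show "(l, m) \<in> (\<lambda>m. (i + j - m, m)) ` {j..i - j}" by blast
    qed
    then show ?thesis
      by (rule finite_subset) simp
  qed
  have fin_dual: "finite {s \<in> S. f s s' \<noteq> 0}" if "s' \<in> - S" for s'
  proof -
    obtain l m where s': "s' = (l, m)" by fastforce
    \<comment> \<open>Now j varies: l < m+j bounds it below, and 2j <= l < 2m bounds it
      above.\<close>
    have "{s \<in> S. f s s' \<noteq> 0} \<subseteq> (\<lambda>j. (l + m - j, j)) ` {l - m..m}"
    proof clarify
      fix i j assume "(i, j) \<in> S" "f (i, j) s' \<noteq> 0"
      then have "i + j = l + m \<and> 2 * j \<le> l \<and> l < m + j"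
        using nz that s' compl by blast
      moreover have "l < 2 * m"
        using that s' S by auto
      ultimately have "i = l + m - j" "j \<in> {l - m..m}" by auto
      then show "(i, j) \<in> (\<lambda>j. (l + m - j, j)) ` {l - m..m}" by blast
    qed
    then show ?thesis
      by (rule finite_subset) simp
  qed
  have "dualizable (admissible_coalgebra S f) S f"
    using fin fin_dual by (simp add: dualizable_def admissible_presentation_def)
  moreover have "bij ?\<sigma>"
    by (rule o_bij[where g = ?\<sigma>]) auto
  \<comment> \<open>The involution swaps the two regions: over the integers, 1-i < 2(1-j) iff 2j <
    i+1 iff 2j <= i.\<close>
  moreover have "bij_betw (map_prod ?\<sigma> ?\<sigma>) S (- S)"
    by (rule bij_betw_byWitness[where f' = "map_prod ?\<sigma> ?\<sigma>"]) (auto simp: S)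
  moreover have "f s s' = dual_function f (map_prod ?\<sigma> ?\<sigma> s) (map_prod ?\<sigma> ?\<sigma> s')"
    if "s \<in> S" "s' \<in> - S" for s s'
  proof -
    obtain i j l m where s: "s = (i, j)" and s': "s' = (l, m)" by fastforce
    have f1: "f (i, j) (l, m) =
        (if i + j = l + m then of_nat (int_binomial (m - j - 1) (m + j - l - 1)) else 0)"
      by (rule f) (use that s s' compl in auto)
    \<comment> \<open>\<open>dual_function\<close> exchanges its arguments, so the image of s' comes
      first.\<close>
    have f2: "f (1 - l, 1 - m) (1 - i, 1 - j) =
        (if (1 - l) + (1 - m) = (1 - i) + (1 - j)
         then of_nat (int_binomial ((1 - j) - (1 - m) - 1) ((1 - j) + (1 - m) - (1 - i) - 1))
         else 0)"
      by (rule f) (use that s s' S S' in auto)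
    have "int_binomial (m - j - 1) (m + j - l - 1) = int_binomial (m - j - 1) (i - j - m)"
      if eq: "i + j = l + m"
    proof -
      have "2 * j \<le> i" "l < 2 * m"
        using \<open>s \<in> S\<close> \<open>s' \<in> - S\<close> s s' S by auto
      \<comment> \<open>Adding j and m respectively: 3j <= i+j = l+m < 3m, hence j < m.\<close>
      then have "0 \<le> m - j - 1"
        using eq by linarith
      moreover have "i - j - m = (m - j - 1) - (m + j - l - 1)"
        using eq by linarith
      ultimately show ?thesis
        using int_binomial_symmetric[of "m - j - 1" "m + j - l - 1"] by presburger
    qed
    then show ?thesis
      using f1 f2 by (auto simp: s s' dual_function_def algebra_simps)
  qed
  ultimately show ?thesis
    by (simp add: strictly_self_dual_def compl)
qed

end
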